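(* Let $\mathcal{G}$ be a non-degenerate Hessenberg matrix, let $\mathcal{M}_{\mathcal{G}}$ be its associated matrix of formal moments, and let $\eta\in\mathbb{Z}_+$ be fixed. Then $$\Psi(\mathcal{G},\eta)=(-1)^{\eta}\,\mathcal{T}\,\Phi(\mathcal{M}_{\mathcal{G}},\eta)\,\mathcal{T}^{\mathsf T}.$$
   Context: $\mathbb{Z}_+=\{0,1,2,\dots\}$. Infinite matrices have real entries indexed by $(i,j)\in\mathbb{Z}_+\times\mathbb{Z}_+$. All products of infinite matrices considered are such that each entry is a sum with finitely many nonzero terms. $\mathcal{U}$ is the infinite matrix with $(i,j)$ entry $\delta_{i+1,j}$; $\mathcal{U}^{-1}:=\mathcal{U}^{\mathsf T}$ is its right-hand inverse and $\mathcal{U}^{-m}:=(\mathcal{U}^{-1})^m$. A non-degenerate Hessenberg matrix is an infinite real matrix $\mathcal{G}=(g_{i,j})_{i,j\ge0}$ with $g_{i,j}=0$ whenever $j-i>1$ and $g_{i,i+1}\neq 0$ for all $i\ge 0$. The polynomials $\{Q_n\}$ generated by $\mathcal{G}$ are defined by $Q_0=t_{0,0}$ (a fixed constant $t_{0,0}>0$) and $g_{n,n+1}Q_{n+1}(x)=xQ_n(x)-\sum_{k=0}^n g_{n,k}Q_k(x)$, $n\ge 0$; $\deg Q_n=n$. Write $Q_n(x)=\sum_{i=0}^n t_{n,i}x^i$ and let $\mathcal{T}=(t_{n,i})$ be the corresponding lower triangular infinite matrix ($t_{n,i}=0$ for $i>n$); it has a unique two-sided lower triangular inverse $\mathcal{T}^{-1}$.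 With $\mathcal{T}^{-\mathsf T}=(\mathcal{T}^{-1})^{\mathsf T}$, the matrix of formal moments of $\mathcal{G}$ is $\mathcal{M}_{\mathcal{G}}:=\mathcal{T}^{-1}\mathcal{T}^{-\mathsf T}$. For an infinite matrix $\mathcal{A}$, $\Phi(\mathcal{A},\eta):=\sum_{\ell=0}^{\eta}(-1)^\ell\binom{\eta}{\ell}\,\mathcal{U}^{\eta-\ell}\mathcal{A}\,\mathcal{U}^{-\ell}$. For a lower Hessenberg infinite matrix $\mathcal{B}$, $\Psi(\mathcal{B},\eta):=\sum_{k=0}^{\eta}(-1)^k\binom{\eta}{k}\,\mathcal{B}^k\,\mathcal{B}^{(\eta-k)\mathsf T}$, where $\mathcal{B}^{m\mathsf T}=(\mathcal{B}^m)^{\mathsf T}$. *)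

theory Defs
  imports
    Complex_Main
    "HOL-Library.Groups_Big_Fun"
    "HOL-Computational_Algebra.Polynomial"
begin

type_synonym imat = "nat \<Rightarrow> nat \<Rightarrow> real"

(* Sum_any sums over the indices with nonzero summand and returns the default value 0 when there
   are infinitely many of them.  All products formed below have finitely many nonzero terms in
   each entry.  The product of arbitrary infinite matrices is not associative; it
   associates to the left here. *)
definition imat_mult :: "imat \<Rightarrow> imat \<Rightarrow> imat"  (infixl "\<odot>" 70) where
  "A \<odot> B = (\<lambda>i j. Sum_any (\<lambda>k. A i k * B k j))"

definition imat_id :: imat where
  "imat_id = (\<lambda>i j. if i = j then 1 else 0)"

primrec imat_pow :: "imat \<Rightarrow> nat \<Rightarrow> imat" where
  "imat_pow A 0 = imat_id"
| "imat_pow A (Suc n) = A \<odot> imat_pow A n"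

definition imat_transpose :: "imat \<Rightarrow> imat" where
  "imat_transpose A = (\<lambda>i j. A j i)"

definition lower_triangular :: "imat \<Rightarrow> bool" where
  "lower_triangular A \<longleftrightarrow> (\<forall>i j. i < j \<longrightarrow> A i j = 0)"

(* Meaningful for lower triangular A with nonzero diagonal entries, for which such a B exists
   and is unique. *)
definition lt_inverse :: "imat \<Rightarrow> imat" where
  "lt_inverse A = (THE B. lower_triangular B \<and> A \<odot> B = imat_id \<and> B \<odot> A = imat_id)"

definition shift :: imat where
  "shift = (\<lambda>i j. if i + 1 = j then 1 else 0)"

(* Only a right inverse of shift. *)
definition shift_inv :: imat where
  "shift_inv = imat_transpose shift"

definition nondegenerate_Hessenberg :: "imat \<Rightarrow> bool" where
  "nondegenerate_Hessenberg G \<longleftrightarrow>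
     (\<forall>i j. i + 1 < j \<longrightarrow> G i j = 0) \<and> (\<forall>i. G i (i + 1) \<noteq> 0)"

(* The parameter t is the constant polynomial Q_0; the recurrence is solved for Q_{n+1}. *)
fun gen_poly :: "imat \<Rightarrow> real \<Rightarrow> nat \<Rightarrow> real poly" where
  "gen_poly G t 0 = [:t:]"
| "gen_poly G t (Suc n) =
     smult (1 / G n (Suc n))
       ([:0, 1:] * gen_poly G t n - (\<Sum>k\<le>n. smult (G n k) (gen_poly G t k)))"

lemma gen_poly_recurrence:
  assumes "nondegenerate_Hessenberg G"
  shows "smult (G n (n + 1)) (gen_poly G t (n + 1)) =
           [:0, 1:] * gen_poly G t n - (\<Sum>k=0..n. smult (G n k) (gen_poly G t k))"
  using assms by (simp add: nondegenerate_Hessenberg_def atLeast0AtMost)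

definition coeff_matrix :: "imat \<Rightarrow> real \<Rightarrow> imat" where
  "coeff_matrix G t = (\<lambda>n i. coeff (gen_poly G t n) i)"

definition formal_moments :: "imat \<Rightarrow> real \<Rightarrow> imat" where
  "formal_moments G t =
     lt_inverse (coeff_matrix G t) \<odot> imat_transpose (lt_inverse (coeff_matrix G t))"

definition Phi :: "imat \<Rightarrow> nat \<Rightarrow> imat" where
  "Phi A \<eta> = (\<lambda>i j. \<Sum>l=0..\<eta>. (-1) ^ l * real (\<eta> choose l) *
     (imat_pow shift (\<eta> - l) \<odot> A \<odot> imat_pow shift_inv l) i j)"

definition Psi :: "imat \<Rightarrow> nat \<Rightarrow> imat" where
  "Psi B \<eta> = (\<lambda>i j. \<Sum>k=0..\<eta>. (-1) ^ k * real (\<eta> choose k) *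
     (imat_pow B k \<odot> imat_transpose (imat_pow B (\<eta> - k))) i j)"

end

(* The recurrence for the polynomials says G T = T U.  Hence G^k = T U^k S with S the inverse of T,
   and G^k (G^m)^T = T (U^k S S^T U^{-m}) T^T = T (U^k M U^{-m}) T^T.  Summing over k + m = eta and
   reversing the order of summation gives the theorem.  The reassociations are legitimate because
   in each of them the outer left factor has finite rows, and either the middle factor has finite
   rows or the right factor has finite columns. *)

theory Submission
  imports Defs
begin

section \<open>Finite rows and columns: when products associate and are linear\<close>

definition row_finite :: "imat \<Rightarrow> bool" where
  "row_finite A \<longleftrightarrow> (\<forall>i. finite {j. A i j \<noteq> 0})"

abbreviation col_finite :: "imat \<Rightarrow> bool" where
  "col_finite A \<equiv> row_finite (imat_transpose A)"

lemma imat_transpose_transpose [simp]: "imat_transpose (imat_transpose A) = A"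
  by (simp add: imat_transpose_def)

lemma imat_transpose_mult:
  "imat_transpose (A \<odot> B) = imat_transpose B \<odot> imat_transpose A"
  by (simp add: imat_transpose_def imat_mult_def mult.commute)

lemma imat_mult_eq_sum:
  assumes "finite K" and "\<And>k. k \<notin> K \<Longrightarrow> A i k * B k j = 0"
  shows "(A \<odot> B) i j = (\<Sum>k\<in>K. A i k * B k j)"
  unfolding imat_mult_def using assms by (intro Sum_any.expand_superset) auto

lemma imat_mult_row_finite:
  assumes "row_finite A"
  shows "(A \<odot> B) i j = (\<Sum>k | A i k \<noteq> 0. A i k * B k j)"
  using assms by (intro imat_mult_eq_sum) (auto simp: row_finite_def)

text \<open>Both sides are the same finite double sum, over the support of row \<open>i\<close> of
  \<open>A\<close> and over \<open>L\<close>. The point is that one finite \<open>L\<close> serves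
  every \<open>k\<close> in that support.\<close>

lemma imat_mult_assoc_aux:
  assumes A: "row_finite A" and "finite L"
    and L: "\<And>k l. A i k \<noteq> 0 \<Longrightarrow> l \<notin> L \<Longrightarrow> B k l * C l j = 0"
  shows "(A \<odot> B \<odot> C) i j = (A \<odot> (B \<odot> C)) i j"
proof -
  let ?K = "{k. A i k \<noteq> 0}"
  have "(A \<odot> B) i l * C l j = (\<Sum>k\<in>?K. A i k * (B k l * C l j))" for l
    by (simp add: imat_mult_row_finite[OF A] sum_distrib_right mult.assoc)
  \<comment> \<open>Row \<open>i\<close> of \<open>A \<odot> B\<close> may be infinite; the
    vanishing of these products still confines the outer sum to \<open>L\<close>.\<close>
  moreover from this have "(A \<odot> B) i l * C l j = 0" if "l \<notin> L" for l
    using L[OF _ that] by (auto intro!: sum.neutral)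
  ultimately have "(A \<odot> B \<odot> C) i j = (\<Sum>l\<in>L. \<Sum>k\<in>?K. A i k * (B k l * C l j))"
    using \<open>finite L\<close> by (subst imat_mult_eq_sum[where K = L]) auto
  also have "\<dots> = (\<Sum>k\<in>?K. A i k * (\<Sum>l\<in>L. B k l * C l j))"
    by (subst sum.swap) (simp add: sum_distrib_left)
  also have "\<dots> = (\<Sum>k\<in>?K. A i k * (B \<odot> C) k j)"
    using L \<open>finite L\<close> by (intro sum.cong refl) (subst imat_mult_eq_sum[where K = L], auto)
  finally show ?thesis
    by (simp add: imat_mult_row_finite[OF A])
qed

text \<open>Row \<open>i\<close> of \<open>A\<close> meets finitely many rows of \<open>B\<close>,
  each finite, so the union of their supports can serve as \<open>L\<close>.\<close>

lemma imat_mult_assoc_rr: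
  assumes "row_finite A" and "row_finite B"
  shows "A \<odot> B \<odot> C = A \<odot> (B \<odot> C)"
proof (intro ext)
  fix i j
  show "(A \<odot> B \<odot> C) i j = (A \<odot> (B \<odot> C)) i j"
    using assms
    by (intro imat_mult_assoc_aux[where L = "\<Union>k\<in>{k. A i k \<noteq> 0}. {l. B k l \<noteq> 0}"])
      (auto simp: row_finite_def)
qed

text \<open>Here the support of column \<open>j\<close> of \<open>C\<close> serves as
  \<open>L\<close>. This covers middle factors such as the moment matrix, which may have infinite
  rows.\<close>

lemma imat_mult_assoc_rc:
  assumes "row_finite A" and "col_finite C"
  shows "A \<odot> B \<odot> C = A \<odot> (B \<odot> C)"
proof (intro ext)
  fix i j
  show "(A \<odot> B \<odot> C) i j = (A \<odot> (B \<odot> C)) i j"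
    using assms
    by (intro imat_mult_assoc_aux[where L = "{l. C l j \<noteq> 0}"])
      (auto simp: row_finite_def imat_transpose_def)
qed

text \<open>\<open>Sum_any\<close> is 0 on infinite supports and hence not additive in general;
  finite rows of \<open>A\<close> turn the claim into a swap of ordinary sums.\<close>

lemma imat_mult_sum_right:
  assumes "row_finite A"
  shows "A \<odot> (\<lambda>i j. \<Sum>l\<in>I. c l * X l i j) = (\<lambda>i j. \<Sum>l\<in>I. c l * (A \<odot> X l) i j)"
proof (intro ext)
  fix i j
  have "(\<Sum>k | A i k \<noteq> 0. A i k * (\<Sum>l\<in>I. c l * X l k j)) =
      (\<Sum>l\<in>I. c l * (\<Sum>k | A i k \<noteq> 0. A i k * X l k j))"
    by (simp add: sum_distrib_left mult.left_commute) (rule sum.swap)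
  then show "(A \<odot> (\<lambda>i j. \<Sum>l\<in>I. c l * X l i j)) i j = (\<Sum>l\<in>I. c l * (A \<odot> X l) i j)"
    by (simp add: imat_mult_row_finite[OF assms])
qed

lemma imat_mult_sum_left:
  assumes "col_finite A"
  shows "(\<lambda>i j. \<Sum>l\<in>I. c l * X l i j) \<odot> A = (\<lambda>i j. \<Sum>l\<in>I. c l * (X l \<odot> A) i j)"
proof -
  have "imat_transpose ((\<lambda>i j. \<Sum>l\<in>I. c l * X l i j) \<odot> A) =
      imat_transpose A \<odot> (\<lambda>i j. \<Sum>l\<in>I. c l * imat_transpose (X l) i j)"
    by (simp add: imat_transpose_mult) (simp add: imat_transpose_def)
  also have "\<dots> = (\<lambda>i j. \<Sum>l\<in>I. c l * imat_transpose (X l \<odot> A) i j)"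
    by (simp add: imat_mult_sum_right[OF assms] imat_transpose_mult)
  finally show ?thesis
    by (simp add: imat_transpose_def fun_eq_iff)
qed

lemma imat_mult_id_left [simp]: "imat_id \<odot> A = A"
proof (intro ext)
  fix i j
  show "(imat_id \<odot> A) i j = A i j"
    by (subst imat_mult_eq_sum[where K = "{i}"]) (auto simp: imat_id_def)
qed

lemma imat_mult_id_right [simp]: "A \<odot> imat_id = A"
proof (intro ext)
  fix i j
  show "(A \<odot> imat_id) i j = A i j"
    by (subst imat_mult_eq_sum[where K = "{j}"]) (auto simp: imat_id_def)
qed

lemma row_finite_mult:
  assumes "row_finite A" and "row_finite B"
  shows "row_finite (A \<odot> B)"
  unfolding row_finite_def
proof
  fix i
  have "{j. (A \<odot> B) i j \<noteq> 0} \<subseteq> (\<Union>k\<in>{k. A i k \<noteq> 0}. {j. B k j \<noteq> 0})"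
    by (auto simp: imat_mult_row_finite[OF assms(1)] elim!: sum.not_neutral_contains_not_neutral)
  then show "finite {j. (A \<odot> B) i j \<noteq> 0}"
    by (rule finite_subset) (use assms in \<open>auto simp: row_finite_def\<close>)
qed

lemma row_finite_id: "row_finite imat_id"
  by (simp add: row_finite_def imat_id_def)

lemma row_finite_pow: "row_finite A \<Longrightarrow> row_finite (imat_pow A n)"
  by (induction n) (auto intro: row_finite_id row_finite_mult)

lemma row_finite_lower_triangular:
  assumes "lower_triangular A"
  shows "row_finite A"
  unfolding row_finite_def
proof
  fix i
  have "{j. A i j \<noteq> 0} \<subseteq> {..i}"
    using assms by (auto simp: lower_triangular_def intro: leI)
  then show "finite {j. A i j \<noteq> 0}"
    by (rule finite_subset) simp
qed

lemma row_finite_Hessenberg: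
  assumes "nondegenerate_Hessenberg G"
  shows "row_finite G"
  unfolding row_finite_def
proof
  fix i
  have "{j. G i j \<noteq> 0} \<subseteq> {..i + 1}"
    using assms by (auto simp: nondegenerate_Hessenberg_def intro: leI)
  then show "finite {j. G i j \<noteq> 0}"
    by (rule finite_subset) simp
qed

subsection \<open>Inverses of lower triangular matrices\<close>

text \<open>Forward substitution: entry \<open>(i, j)\<close> of the equation
  \<open>A \<odot> B = imat_id\<close>, solved for \<open>B i j\<close>.\<close>

fun forward_subst :: "imat \<Rightarrow> nat \<Rightarrow> nat \<Rightarrow> real" where
  "forward_subst A i j = (imat_id i j - (\<Sum>k<i. A i k * forward_subst A k j)) / A i i"

declare forward_subst.simps [simp del]

lemma forward_subst_upper: "i < j \<Longrightarrow> forward_subst A i j = 0"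
  by (induction i rule: less_induct) (subst forward_subst.simps, simp add: imat_id_def)

lemma lower_triangular_forward_subst: "lower_triangular (forward_subst A)"
  by (simp add: lower_triangular_def forward_subst_upper)

lemma forward_subst_diag: "forward_subst A i i = 1 / A i i"
  by (subst forward_subst.simps) (simp add: forward_subst_upper imat_id_def)

lemma forward_subst_right_inverse:
  assumes "lower_triangular A" and "\<And>i. A i i \<noteq> 0"
  shows "A \<odot> forward_subst A = imat_id"
proof (intro ext)
  fix i j
  have "(A \<odot> forward_subst A) i j = (\<Sum>k\<le>i. A i k * forward_subst A k j)"
    using assms(1) by (intro imat_mult_eq_sum) (auto simp: lower_triangular_def)
  also have "\<dots> = (\<Sum>k<i. A i k * forward_subst A k j) + A i i * forward_subst A i j"
    by (simp flip: lessThan_Suc_atMost)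
  also have "\<dots> = imat_id i j"
    \<comment> \<open>Only the term with k = i is unfolded; its numerator cancels the sum over k <
      i.\<close>
    using assms(2) by (subst (2) forward_subst.simps) simp
  finally show "(A \<odot> forward_subst A) i j = imat_id i j" .
qed

text \<open>The right inverse \<open>?B\<close> is again lower triangular with nonzero diagonal, so
  it has a right inverse \<open>?C\<close>. Associativity forces \<open>?C = A\<close>, which makes
  \<open>?B\<close> two-sided, and a two-sided inverse is unique.\<close>

lemma lower_triangular_inverse_ex1:
  assumes A: "lower_triangular A" and "\<And>i. A i i \<noteq> 0"
  shows "\<exists>!B. lower_triangular B \<and> A \<odot> B = imat_id \<and> B \<odot> A = imat_id"
proof -
  note rf = row_finite_lower_triangular
  let ?B = "forward_subst A"
  let ?C = "forward_subst ?B"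
  note B = lower_triangular_forward_subst[of A]
  have AB: "A \<odot> ?B = imat_id"
    by (rule forward_subst_right_inverse) fact+
  have BC: "?B \<odot> ?C = imat_id"
    using assms(2) B by (intro forward_subst_right_inverse) (simp_all add: forward_subst_diag)
  have "A = A \<odot> (?B \<odot> ?C)"
    by (simp add: BC)
  also have "\<dots> = ?C"
    by (simp add: AB imat_mult_assoc_rr[symmetric] rf A B)
  finally have BA: "?B \<odot> A = imat_id"
    using BC by simp
  show ?thesis
  proof (rule ex1I[of _ ?B])
    show "lower_triangular ?B \<and> A \<odot> ?B = imat_id \<and> ?B \<odot> A = imat_id"
      using B AB BA by simp
  next
    fix B' assume B': "lower_triangular B' \<and> A \<odot> B' = imat_id \<and> B' \<odot> A = imat_id"
    have "B' = B' \<odot> (A \<odot> ?B)"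
      by (simp add: AB)
    also have "\<dots> = ?B"
      using B' A by (simp add: imat_mult_assoc_rr[symmetric] rf)
    finally show "B' = ?B" .
  qed
qed

lemma lt_inverse:
  assumes "lower_triangular A" and "\<And>i. A i i \<noteq> 0"
  shows lower_triangular_lt_inverse: "lower_triangular (lt_inverse A)"
    and lt_inverse_right: "A \<odot> lt_inverse A = imat_id"
  using theI'[OF lower_triangular_inverse_ex1[OF assms]] unfolding lt_inverse_def by auto

subsection \<open>Powers of the shift\<close>

lemma imat_pow_shift: "imat_pow shift n = (\<lambda>i j. if i + n = j then 1 else 0)"
proof (induction n)
  case 0
  then show ?case by (simp add: imat_id_def)
next
  case (Suc n)
  show ?case
  proof (intro ext)
    fix i j
    show "imat_pow shift (Suc n) i j = (if i + Suc n = j then 1 else 0)"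
      by (simp only: imat_pow.simps Suc, subst imat_mult_eq_sum[where K = "{i + 1}"])
        (auto simp: shift_def)
  qed
qed

lemma imat_pow_shift_inv: "imat_pow shift_inv n = imat_transpose (imat_pow shift n)"
proof (induction n)
  case 0
  then show ?case by (simp add: imat_id_def imat_transpose_def eq_commute)
next
  case (Suc n)
  show ?case
  proof (intro ext)
    fix i j
    show "imat_pow shift_inv (Suc n) i j = imat_transpose (imat_pow shift (Suc n)) i j"
      \<comment> \<open>For i = 0 the index \<open>i - 1\<close> truncates to 0, which is harmless
        because row 0 of \<open>shift_inv\<close> is zero.\<close>
      by (simp only: imat_pow.simps(2)[of shift_inv] Suc imat_pow_shift,
          subst imat_mult_eq_sum[where K = "{i - 1}"])
        (auto simp: shift_def shift_inv_def imat_transpose_def)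
  qed
qed

lemma row_finite_shift: "row_finite shift"
  by (simp add: row_finite_def shift_def)

subsection \<open>The coefficient matrix\<close>

lemma degree_gen_poly: "degree (gen_poly G t n) \<le> n"
proof (induction n rule: less_induct)
  case (less n)
  show ?case
  proof (cases n)
    case (Suc m)
    have "degree ([:0, 1:] * gen_poly G t m) \<le> Suc m"
      using degree_mult_le[of "[:0, 1:]" "gen_poly G t m"] less[of m] Suc by simp
    moreover have "degree (\<Sum>k\<le>m. smult (G m k) (gen_poly G t k)) \<le> Suc m"
    proof (rule degree_sum_le)
      fix k assume "k \<in> {..m}"
      then show "degree (smult (G m k) (gen_poly G t k)) \<le> Suc m"
        using less[of k] Suc degree_smult_le[of "G m k" "gen_poly G t k"] by simp
    qed simp
    ultimately show ?thesis
      using Suc by (auto intro!: degree_diff_le order.trans[OF degree_smult_le])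
  qed simp
qed

lemma lower_triangular_coeff_matrix: "lower_triangular (coeff_matrix G t)"
  by (auto simp: lower_triangular_def coeff_matrix_def
      intro!: coeff_eq_0 le_less_trans[OF degree_gen_poly])

text \<open>Only x Q_n reaches degree n + 1 in the recurrence, so each leading coefficient is the
  previous one divided by the nonzero \<open>G n (Suc n)\<close>.\<close>

lemma coeff_matrix_diag_nonzero:
  assumes "nondegenerate_Hessenberg G" and "t \<noteq> 0"
  shows "coeff_matrix G t n n \<noteq> 0"
proof (induction n)
  case 0
  show ?case using \<open>t \<noteq> 0\<close> by (simp add: coeff_matrix_def)
next
  case (Suc n)
  have "coeff (gen_poly G t k) (Suc n) = 0" if "k \<le> n" for k
    using that by (auto intro!: coeff_eq_0 le_less_trans[OF degree_gen_poly])
  then have "coeff (gen_poly G t (Suc n)) (Suc n) = coeff (gen_poly G t n) n / G n (Suc n)"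
    by (simp add: coeff_sum)
  then show ?case
    using Suc assms(1) by (simp add: coeff_matrix_def nondegenerate_Hessenberg_def)
qed

text \<open>The recurrence read coefficientwise: row n of \<open>G\<close> combines Q_0, ...,
  Q_{n+1} into x Q_n, and multiplication by x moves each coefficient one column to the right, as
  right multiplication by \<open>shift\<close> does.\<close>

lemma Hessenberg_mult_coeff_matrix:
  assumes G: "nondegenerate_Hessenberg G"
  shows "G \<odot> coeff_matrix G t = coeff_matrix G t \<odot> shift"
proof (intro ext)
  fix n i
  have "(G \<odot> coeff_matrix G t) n i = (\<Sum>k\<le>n + 1. G n k * coeff_matrix G t k i)"
    using G by (intro imat_mult_eq_sum) (auto simp: nondegenerate_Hessenberg_def)
  also have "\<dots> = coeff ((\<Sum>k\<le>n. smult (G n k) (gen_poly G t k)) +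
      smult (G n (n + 1)) (gen_poly G t (n + 1))) i"
    by (simp add: coeff_matrix_def coeff_sum del: gen_poly.simps)
  also have "\<dots> = coeff ([:0, 1:] * gen_poly G t n) i"
    by (simp only: gen_poly_recurrence[OF G] atLeast0AtMost add_diff_cancel_left') simp
  also have "\<dots> = (coeff_matrix G t \<odot> shift) n i"
    \<comment> \<open>For i = 0 the truncated index 0 contributes nothing, since column 0 of
      \<open>shift\<close> is zero; this matches the zero constant term of x Q_n.\<close>
    by (subst imat_mult_eq_sum[where K = "{i - 1}"])
      (auto simp: shift_def coeff_matrix_def coeff_pCons split: nat.split)
  finally show "(G \<odot> coeff_matrix G t) n i = (coeff_matrix G t \<odot> shift) n i" .
qed

section \<open>Powers of the Hessenberg matrix and the identity for \<open>Psi\<close>\<close>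

lemma imat_pow_intertwine:
  assumes "A \<odot> T = T \<odot> B" and "row_finite A" and "row_finite T" and "row_finite B"
  shows "imat_pow A n \<odot> T = T \<odot> imat_pow B n"
proof (induction n)
  case (Suc n)
  have "A \<odot> imat_pow A n \<odot> T = A \<odot> T \<odot> imat_pow B n"
    using assms(2-) by (simp only: imat_mult_assoc_rr row_finite_pow Suc)
  also have "\<dots> = T \<odot> (B \<odot> imat_pow B n)"
    using assms(2-) by (simp only: assms(1) imat_mult_assoc_rr[of T])
  finally show ?case
    by simp
qed simp

text \<open>Matches a summand of \<open>Psi\<close> with one of \<open>Phi\<close>, signs and
  binomial coefficients aside.\<close>

lemma Hessenberg_pow_mult_transpose:
  assumes G: "nondegenerate_Hessenberg G" and "t \<noteq> 0"
  shows "imat_pow G k \<odot> imat_transpose (imat_pow G m) =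
    coeff_matrix G t \<odot> (imat_pow shift k \<odot> formal_moments G t \<odot> imat_pow shift_inv m)
      \<odot> imat_transpose (coeff_matrix G t)"
proof -
  let ?T = "coeff_matrix G t"
  let ?S = "lt_inverse ?T"
  let ?U = "imat_pow shift"
  let ?V = "imat_pow shift_inv m"
  note lt = lower_triangular_coeff_matrix[of G t]
  note diag = coeff_matrix_diag_nonzero[OF assms]
  note T [simp] = row_finite_lower_triangular[OF lt]
  note S [simp] = row_finite_lower_triangular[OF lower_triangular_lt_inverse[OF lt diag]]
  have U [simp]: "row_finite (?U n)" for n
    by (simp add: row_finite_pow row_finite_shift)
  have V [simp]: "col_finite ?V"
    by (simp add: imat_pow_shift_inv)
  have pow: "imat_pow G n = ?T \<odot> (?U n \<odot> ?S)" for n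
  proof -
    note Gn = row_finite_pow[OF row_finite_Hessenberg[OF G], of n]
    have "imat_pow G n = imat_pow G n \<odot> (?T \<odot> ?S)"
      by (simp add: lt_inverse_right[OF lt diag])
    also have "\<dots> = imat_pow G n \<odot> ?T \<odot> ?S"
      by (simp add: imat_mult_assoc_rr Gn)
    also have "imat_pow G n \<odot> ?T = ?T \<odot> ?U n"
      by (intro imat_pow_intertwine Hessenberg_mult_coeff_matrix row_finite_Hessenberg
          row_finite_shift G T)
    finally show ?thesis
      by (simp add: imat_mult_assoc_rr)
  qed
  \<comment> \<open>A column of \<open>?S\<close> can be infinite, so \<open>?X\<close> can have
    infinite rows. Where the middle factor may have infinite rows, the finite columns of the
    transpose of \<open>?T\<close> or of \<open>?V\<close> justify the regrouping.\<close>
  let ?X = "imat_transpose ?S \<odot> ?V"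
  have "imat_transpose (imat_pow G m) = ?X \<odot> imat_transpose ?T"
    by (simp add: pow imat_transpose_mult imat_pow_shift_inv)
  then have "imat_pow G k \<odot> imat_transpose (imat_pow G m) =
      ?T \<odot> (?U k \<odot> ?S) \<odot> (?X \<odot> imat_transpose ?T)"
    by (simp add: pow)
  also have "\<dots> = ?T \<odot> ((?U k \<odot> ?S) \<odot> (?X \<odot> imat_transpose ?T))"
    by (simp add: imat_mult_assoc_rr row_finite_mult)
  also have "\<dots> = ?T \<odot> ((?U k \<odot> ?S) \<odot> ?X) \<odot> imat_transpose ?T"
    by (simp add: imat_mult_assoc_rc row_finite_mult)
  also have "(?U k \<odot> ?S) \<odot> ?X = ?U k \<odot> (?S \<odot> ?X)"
    by (simp add: imat_mult_assoc_rr)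
  also have "?S \<odot> ?X = formal_moments G t \<odot> ?V"
    by (simp add: formal_moments_def imat_mult_assoc_rc)
  also have "?U k \<odot> (formal_moments G t \<odot> ?V) = ?U k \<odot> formal_moments G t \<odot> ?V"
    by (simp add: imat_mult_assoc_rc)
  finally show ?thesis .
qed

theorem theorem9:
  fixes G :: imat and t :: real and \<eta> :: nat
  assumes "nondegenerate_Hessenberg G" and "t > 0"
  shows "Psi G \<eta> =
    (\<lambda>i j. (-1) ^ \<eta> *
      (coeff_matrix G t \<odot> Phi (formal_moments G t) \<eta> \<odot> imat_transpose (coeff_matrix G t)) i j)"
proof (intro ext)
  fix i j
  let ?T = "coeff_matrix G t"
  let ?Y = "\<lambda>l. imat_pow shift (\<eta> - l) \<odot> formal_moments G t \<odot> imat_pow shift_inv l"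
  let ?Z = "\<lambda>l. (?T \<odot> ?Y l \<odot> imat_transpose ?T) i j"
  have T: "row_finite ?T"
    by (rule row_finite_lower_triangular[OF lower_triangular_coeff_matrix])
  \<comment> \<open>Substituting \<eta> - l for k aligns the exponent of \<open>G\<close> with the
    exponent of \<open>shift\<close> in \<open>Phi\<close>.\<close>
  have "Psi G \<eta> i j = (\<Sum>l=0..\<eta>. (-1) ^ (\<eta> - l) * real (\<eta> choose (\<eta> - l)) *
      (imat_pow G (\<eta> - l) \<odot> imat_transpose (imat_pow G (\<eta> - (\<eta> - l)))) i j)"
    unfolding Psi_def by (subst sum.atLeastAtMost_rev) simp
  also have "\<dots> = (\<Sum>l=0..\<eta>. (-1) ^ \<eta> * ((-1) ^ l * real (\<eta> choose l) * ?Z l))"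
  proof (intro sum.cong refl)
    fix l assume "l \<in> {0..\<eta>}"
    then have l: "l \<le> \<eta>" by simp
    \<comment> \<open>The global sign arises here: \<eta> - l and \<eta> + l have the same
      parity.\<close>
    then have "(-1 :: real) ^ (\<eta> - l) = (-1) ^ \<eta> * (-1) ^ l"
      by (simp add: power_diff power_add minus_one_power_iff)
    with l show "(-1) ^ (\<eta> - l) * real (\<eta> choose (\<eta> - l)) *
        (imat_pow G (\<eta> - l) \<odot> imat_transpose (imat_pow G (\<eta> - (\<eta> - l)))) i j =
        (-1) ^ \<eta> * ((-1) ^ l * real (\<eta> choose l) * ?Z l)"
      using assms by (simp add: Hessenberg_pow_mult_transpose[of G t] binomial_symmetric[OF l])
  qed
  \<comment> \<open>Finite rows of \<open>?T\<close> give linearity for the left factor and, after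
    transposition, for the right one.\<close>
  also have "\<dots> = (-1) ^ \<eta> * (?T \<odot> Phi (formal_moments G t) \<eta> \<odot> imat_transpose ?T) i j"
    by (simp add: Phi_def imat_mult_sum_right[OF T] imat_mult_sum_left T sum_distrib_left)
  finally show "Psi G \<eta> i j =
      (-1) ^ \<eta> * (?T \<odot> Phi (formal_moments G t) \<eta> \<odot> imat_transpose ?T) i j" .
qed

end
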